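(* Let $\nu$ be a complex number that is not a negative integer, and let $D_{n,\nu}(q) = \prod_{k=1}^n [k+\nu]_q^{\lfloor n/k \rfloor}$. Then there exist polynomials $N_{n,\nu}(q)$, $n\ge1$, in $q$, $q^\nu$ and $[\nu]_q$ with nonnegative integer coefficients such that, as formal power series in $z$, both \[ \frac{J_{\nu+1}((1-q)z;q^{-1})}{J_\nu((1-q)z;q^{-1})} = - \sum_{n=1}^{\infty} \frac{N_{n,\nu}(q)}{D_{n,\nu}(q)} q^{(\nu+1)n} z^{2n-1} \] and \[ \frac{J_{\nu+1}((1-q)q^{1/2}z;q)}{J_\nu((1-q)z;q)} = q^{(\nu-1)/2} \sum_{n\ge1}\frac{N_{n,\nu}(q)}{D_{n,\nu}(q)} q^n z^{2n-1} \] hold.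
   Context: Notation: $(a;p)_n=(1-a)(1-ap)\cdots(1-ap^{n-1})$, $(a;p)_\infty=\prod_{i\ge0}(1-ap^i)$, and $[x]_q=(1-q^x)/(1-q)$. The Hahn–Exton $q$-Bessel function with base $p$ is $J_\nu(w;p)=\frac{(p^{\nu+1};p)_\infty w^\nu}{(p;p)_\infty}\Phi_\nu(w;p)$, where $\Phi_\nu(w;p)=\sum_{n\ge0}\frac{(-1)^n p^{\binom n2}(p w^2)^n}{(p;p)_n(p^{\nu+1};p)_n}$. Thus $\frac{J_{\nu+1}(w;p)}{J_\nu(w;p)}=\frac{w}{1-p^{\nu+1}}\frac{\Phi_{\nu+1}(w;p)}{\Phi_\nu(w;p)}$ (for $p=q^{-1}$ understood as this formal power series in $w$), and $\frac{J_{\nu+1}(q^{1/2}w;q)}{J_\nu(w;q)}=\frac{q^{(\nu+1)/2}w}{1-q^{\nu+1}}\frac{\Phi_{\nu+1}(q^{1/2}w;q)}{\Phi_\nu(w;q)}$. *)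

theory Defs
  imports "HOL-Analysis.Analysis" "HOL-Computational_Algebra.Computational_Algebra"
begin

definition qpoch :: "complex \<Rightarrow> complex \<Rightarrow> nat \<Rightarrow> complex" where
  "qpoch a p n = (\<Prod>i<n. 1 - a * p ^ i)"

definition qpoch_inf :: "complex \<Rightarrow> complex \<Rightarrow> complex" where
  "qpoch_inf a p = (\<Prod>i. 1 - a * p ^ i)"

definition qnum :: "complex \<Rightarrow> complex \<Rightarrow> complex" where
  "qnum q x = (1 - q powr x) / (1 - q)"

text \<open>The power series \<open>\<Phi>\<^sub>\<nu>(w; p)\<close> in the variable \<open>w\<close>; only even powers of \<open>w\<close> occur.
  Powers with complex exponents are principal values throughout.\<close>

definition hahn_exton_Phi :: "complex \<Rightarrow> complex \<Rightarrow> complex fps" where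
  "hahn_exton_Phi \<nu> p = Abs_fps (\<lambda>m. if even m then
     (let n = m div 2
      in (-1) ^ n * p ^ (n choose 2) * p ^ n / (qpoch p p n * qpoch (p powr (\<nu> + 1)) p n))
     else 0)"

text \<open>For \<open>|p| < 1\<close>, \<open>J\<^sub>\<nu>(c z; p) = z\<^sup>\<nu> F(z)\<close> where the power series \<open>F\<close> is
  \<open>hahn_exton_J \<nu> p c\<close>: the factor \<open>z\<^sup>\<nu>\<close>, which is not a formal power series, is split off.\<close>

definition hahn_exton_J :: "complex \<Rightarrow> complex \<Rightarrow> complex \<Rightarrow> complex fps" where
  "hahn_exton_J \<nu> p c =
     fps_const (qpoch_inf (p powr (\<nu> + 1)) p * c powr \<nu> / qpoch_inf p p) *
     (hahn_exton_Phi \<nu> p oo (fps_const c * fps_X))"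

text \<open>The quotient \<open>J\<^bsub>\<nu>+1\<^esub>(c z; p) / J\<^sub>\<nu>(d z; p)\<close> as a power series in \<open>z\<close>, for \<open>|p| < 1\<close>;
  the split-off factors contribute \<open>z\<^bsup>\<nu>+1\<^esup> / z\<^sup>\<nu> = z\<close>.\<close>

definition hahn_exton_quot :: "complex \<Rightarrow> complex \<Rightarrow> complex \<Rightarrow> complex \<Rightarrow> complex fps" where
  "hahn_exton_quot \<nu> p c d = fps_X * (hahn_exton_J (\<nu> + 1) p c / hahn_exton_J \<nu> p d)"

text \<open>The quotient \<open>J\<^bsub>\<nu>+1\<^esub>(c z; p) / J\<^sub>\<nu>(c z; p)\<close> as a formal power series in \<open>z\<close>, namely
  \<open>w / (1 - p\<^bsup>\<nu>+1\<^esup>) \<cdot> \<Phi>\<^bsub>\<nu>+1\<^esub>(w; p) / \<Phi>\<^sub>\<nu>(w; p)\<close> at \<open>w = c z\<close>. It involves no infinite product, so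
  it makes sense for \<open>|p| > 1\<close>, where \<open>J\<^sub>\<nu>\<close> itself is undefined; for \<open>|p| < 1\<close> it is the actual
  quotient, see \<open>hahn_exton_formal_quot_eq\<close>.\<close>

definition hahn_exton_formal_quot :: "complex \<Rightarrow> complex \<Rightarrow> complex \<Rightarrow> complex fps" where
  "hahn_exton_formal_quot \<nu> p c =
     (fps_const (c / (1 - p powr (\<nu> + 1))) * fps_X) *
     ((hahn_exton_Phi (\<nu> + 1) p oo (fps_const c * fps_X)) /
      (hahn_exton_Phi \<nu> p oo (fps_const c * fps_X)))"

lemma qpoch_inf_nonzero:
  assumes "norm p < 1" and "\<And>i. a * p ^ i \<noteq> 1"
  shows "qpoch_inf a p \<noteq> 0" and "qpoch_inf a p = (1 - a) * qpoch_inf (a * p) p"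
proof -
  have "summable (\<lambda>i. norm ((1 - a * p ^ i) - 1))"
    using assms(1) by (simp add: norm_mult norm_power summable_mult summable_geometric)
  then have conv: "convergent_prod (\<lambda>i. 1 - a * p ^ i)"
    by (intro abs_convergent_prod_imp_convergent_prod summable_imp_abs_convergent_prod)
  show "qpoch_inf a p \<noteq> 0"
    unfolding qpoch_inf_def by (rule prodinf_nonzero[OF conv]) (use assms(2) in auto)
  have a1: "a \<noteq> 1"
    using assms(2)[of 0] by simp
  have "(\<Prod>i. 1 - a * p ^ Suc i) = (\<Prod>i. 1 - a * p ^ i) / (1 - a * p ^ 0)"
    by (rule prodinf_split_head[OF conv]) (use a1 in simp)
  then show "qpoch_inf a p = (1 - a) * qpoch_inf (a * p) p"
    using a1 by (simp add: qpoch_inf_def mult.assoc)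
qed

lemma hahn_exton_formal_quot_eq:
  assumes p: "norm p < 1" "p \<noteq> 0" and c: "c \<noteq> 0"
    and ne: "\<And>k. k \<ge> 1 \<Longrightarrow> p powr (\<nu> + of_nat k) \<noteq> 1"
  shows "hahn_exton_quot \<nu> p c c = hahn_exton_formal_quot \<nu> p c"
proof -
  have shift: "p powr (\<nu> + 1) * p ^ i = p powr (\<nu> + of_nat (Suc i))" for i
    using p by (simp add: powr_add powr_nat' add.commute add.left_commute flip: powr_nat)
  have ne': "p powr (\<nu> + 1) * p ^ i \<noteq> 1" for i
    using ne[of "Suc i"] shift[of i] by simp
  have "norm (p * p ^ i) < 1" for i
    using p power_Suc_less_one[of "norm p" i] by (simp add: norm_mult norm_power mult.commute)
  then have "p * p ^ i \<noteq> 1" for i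
    by (metis norm_one less_irrefl)
  then have pp: "qpoch_inf p p \<noteq> 0"
    using qpoch_inf_nonzero(1) p by blast
  let ?A = "qpoch_inf (p powr (\<nu> + 1)) p" and ?B = "qpoch_inf (p powr (\<nu> + 1 + 1)) p"
  have sh: "p powr (\<nu> + 1 + 1) = p powr (\<nu> + 1) * p"
    using p(2) powr_add[of p "\<nu> + 1" 1] by simp
  have A: "?A \<noteq> 0" "?A = (1 - p powr (\<nu> + 1)) * ?B"
    unfolding sh using qpoch_inf_nonzero[OF p(1) ne'] by blast+
  have "c powr (\<nu> + 1) = c * c powr \<nu>" "c powr \<nu> \<noteq> 0"
    using c by (simp_all add: powr_add)
  then have k: "(?B * c powr (\<nu> + 1) / qpoch_inf p p) / (?A * c powr \<nu> / qpoch_inf p p)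
       = c / (1 - p powr (\<nu> + 1))"
  proof -
    have frac: "(B * (c * e) / d) / (x * B * e / d) = c / x"
      if "B \<noteq> 0" "e \<noteq> 0" "d \<noteq> 0" for B e d x :: complex
      using that by simp
    have "?B \<noteq> 0" using A by auto
    then show ?thesis
      unfolding A(2) \<open>c powr (\<nu> + 1) = c * c powr \<nu>\<close> using \<open>c powr \<nu> \<noteq> 0\<close> pp by (rule frac)
  qed
  let ?F = "hahn_exton_Phi (\<nu> + 1) p oo (fps_const c * fps_X)"
  let ?G = "hahn_exton_Phi \<nu> p oo (fps_const c * fps_X)"
  have G0: "fps_nth ?G 0 \<noteq> 0"
    by (simp add: hahn_exton_Phi_def qpoch_def)
  have quot: "(fps_const x * f) / (fps_const y * g) = fps_const (x / y) * (f / g)"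
    if "y \<noteq> 0" "fps_nth g 0 \<noteq> 0" for x y :: complex and f g
    using that by (simp add: fps_divide_unit fps_inverse_mult fps_const_inverse 
        divide_inverse mult_ac flip: fps_const_mult)
  have "hahn_exton_J (\<nu> + 1) p c / hahn_exton_J \<nu> p c
      = fps_const (c / (1 - p powr (\<nu> + 1))) * (?F / ?G)"
    unfolding hahn_exton_J_def k[symmetric]
    by (rule quot) (use A pp c G0 in auto)
  then show ?thesis
    by (simp add: hahn_exton_quot_def hahn_exton_formal_quot_def mult_ac)
qed

definition kishore_D :: "nat \<Rightarrow> complex \<Rightarrow> complex \<Rightarrow> complex" where
  "kishore_D n \<nu> q = (\<Prod>k=1..n. qnum q (of_nat k + \<nu>) ^ (n div k))"

text \<open>Polynomials in three variables with nonnegative integer coefficients are elements of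
  \<open>((\<nat>[t])[y])[x]\<close>; the following is the value at \<open>(x, y, t)\<close>.\<close>

definition poly3 :: "nat poly poly poly \<Rightarrow> complex \<Rightarrow> complex \<Rightarrow> complex \<Rightarrow> complex" where
  "poly3 P x y t =
     poly (map_poly (\<lambda>R. poly (map_poly (\<lambda>S. poly (map_poly of_nat S) t) R) y) P) x"

text \<open>The formal power series \<open>\<Sum>n\<ge>1. a n * z ^ (2 * n - 1)\<close>.\<close>

definition fps_odd :: "(nat \<Rightarrow> complex) \<Rightarrow> complex fps" where
  "fps_odd a = Abs_fps (\<lambda>m. if odd m then a ((m + 1) div 2) else 0)"

end

theory Submission
  imports Defs
begin

text \<open>
  Put \<open>y = q\<^sup>\<nu>\<close>, \<open>a = y q\<close> and \<open>\<psi>\<^sub>a(u) = \<Sum>\<^sub>n (-1)\<^sup>n q\<^bsup>n(n-1)/2\<^esup> u\<^sup>n / ((q;q)\<^sub>n (a;q)\<^sub>n)\<close>. Then \<open>\<Phi>\<^sub>\<nu>(w; q) = \<psi>\<^sub>a(q w\<^sup>2)\<close>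
  and \<open>\<Phi>\<^sub>\<nu>(w; 1/q) = \<psi>\<^sub>a(a w\<^sup>2)\<close>, so both quotients of Bessel functions are rescalings of one series
  \<open>g(u) = u / (1 - a) \<cdot> \<psi>\<^bsub>a q\<^esub>(q u) / \<psi>\<^sub>a(u)\<close>. Since \<open>1 + g(u) = \<psi>\<^sub>a(q u) / \<psi>\<^sub>a(u)\<close>, the second order
  \<open>q\<close>-difference equation of \<open>\<psi>\<^sub>a\<close> becomes the Riccati equation \<open>g(u) = u (1 + g(u)) + y g(q u) (1 + g(u))\<close>.
  For \<open>s\<^sub>n = (1 - q)\<^bsup>2n-1\<^esup> g\<^sub>n\<close> it reads \<open>[n + \<nu>]\<^sub>q s\<^sub>n = \<Sum>\<^bsub>0<i<n\<^esub> e\<^sub>i s\<^sub>i s\<^bsub>n-i\<^esub>\<close> with \<open>e\<^sub>1 = 1\<close> and \<open>e\<^sub>i = y q\<^sup>i\<close>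
  for \<open>i \<ge> 2\<close>. All coefficients are positive, and clearing denominators gives \<open>s\<^sub>n = N\<^sub>n / D\<^sub>n\<close>.
\<close>

section \<open>Numerator polynomials, their evaluation, and clearing of denominators\<close>

definition semiring_hom :: "('a::comm_semiring_1 \<Rightarrow> 'b::comm_semiring_1) \<Rightarrow> bool" where
  "semiring_hom h \<longleftrightarrow> h 0 = 0 \<and> h 1 = 1 \<and>
     (\<forall>a b. h (a + b) = h a + h b) \<and> (\<forall>a b. h (a * b) = h a * h b)"

lemma semiring_hom_sum: "semiring_hom h \<Longrightarrow> h (sum f A) = (\<Sum>x\<in>A. h (f x))"
  by (induction A rule: infinite_finite_induct) (auto simp: semiring_hom_def)

lemma semiring_hom_prod: "semiring_hom h \<Longrightarrow> h (prod f A) = (\<Prod>x\<in>A. h (f x))"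
  by (induction A rule: infinite_finite_induct) (auto simp: semiring_hom_def)

lemma semiring_hom_power: "semiring_hom h \<Longrightarrow> h (a ^ n) = h a ^ n"
  by (induction n) (auto simp: semiring_hom_def)

text \<open>Three nested applications, one per variable, make \<open>poly3\<close> a homomorphism;
  coefficients in \<open>nat\<close> form only a semiring.\<close>

lemma semiring_hom_poly_map_poly:
  assumes "semiring_hom h"
  shows "semiring_hom (\<lambda>p. poly (map_poly h p) x)"
proof -
  have h: "h 0 = 0" "h 1 = 1" "\<And>a b. h (a + b) = h a + h b" "\<And>a b. h (a * b) = h a * h b"
    using assms by (auto simp: semiring_hom_def)
  let ?e = "\<lambda>p. poly (map_poly h p) x"
  have pCons: "?e (pCons a p) = h a + x * ?e p" for a p
    by (simp add: map_poly_pCons h)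
  have add: "?e (p + r) = ?e p + ?e r" for p r
    by (induction p r rule: poly_induct2) (simp_all add: pCons h algebra_simps)
  have smult: "?e (smult a p) = h a * ?e p" for a p
    by (induction p) (simp_all add: pCons h algebra_simps)
  have "?e (p * r) = ?e p * ?e r" for p r
    by (induction p) (simp_all add: pCons h add smult algebra_simps)
  then show ?thesis
    using add by (simp add: semiring_hom_def one_pCons map_poly_pCons h)
qed

lemma semiring_hom_poly3: "semiring_hom (\<lambda>P. poly3 P x y t)"
  unfolding poly3_def by (intro semiring_hom_poly_map_poly) (simp add: semiring_hom_def)

text \<open>In the variables \<open>x = q\<close>, \<open>y = q\<^sup>\<nu>\<close>, \<open>t = [\<nu>]\<^sub>q\<close>, the polynomials \<open>t + y (1 + x + \<dots> + x\<^bsup>k-1\<^esup>)\<close>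
  represent \<open>[k + \<nu>]\<^sub>q\<close>.\<close>

definition qnum_poly :: "nat \<Rightarrow> nat poly poly poly" where
  "qnum_poly k = [:[:[:0, 1:]:]:] + [:[:0, 1:]:] * (\<Sum>j<k. [:0, 1:] ^ j)"

definition conv_weight :: "'a::comm_semiring_1 \<Rightarrow> 'a \<Rightarrow> nat \<Rightarrow> 'a" where
  "conv_weight x y i = (if i = 1 then 1 else y * x ^ i)"

text \<open>This is the recurrence for \<open>s\<close> multiplied by D_n: the last product
  represents D_n / ([n + \<nu>] D_i D_{n-i}).\<close>

fun kishore_N :: "nat \<Rightarrow> nat poly poly poly" where
  "kishore_N n = (if n \<le> 1 then 1 else
     \<Sum>i\<in>{1..<n}. conv_weight [:0, 1:] [:[:0, 1:]:] i * kishore_N i * kishore_N (n - i) *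
       (\<Prod>k\<in>{1..<n}. qnum_poly k ^ (n div k - i div k - (n - i) div k)))"

declare kishore_N.simps [simp del]

lemma poly3_simps:
  "poly3 1 x y t = 1" "poly3 (P + Q) x y t = poly3 P x y t + poly3 Q x y t"
  "poly3 (P * Q) x y t = poly3 P x y t * poly3 Q x y t" "poly3 (P ^ n) x y t = poly3 P x y t ^ n"
  "poly3 (sum f A) x y t = (\<Sum>i\<in>A. poly3 (f i) x y t)"
  "poly3 (prod f A) x y t = (\<Prod>i\<in>A. poly3 (f i) x y t)"
  using semiring_hom_poly3[of x y t] semiring_hom_power[OF semiring_hom_poly3]
    semiring_hom_sum[OF semiring_hom_poly3] semiring_hom_prod[OF semiring_hom_poly3]
  by (auto simp: semiring_hom_def)

lemma poly3_vars:
  "poly3 [:0, 1:] x y t = x" "poly3 [:[:0, 1:]:] x y t = y" "poly3 [:[:[:0, 1:]:]:] x y t = t"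
  by (simp_all add: poly3_def map_poly_pCons one_pCons)

lemma poly3_qnum_poly: "poly3 (qnum_poly k) x y t = t + y * (\<Sum>j<k. x ^ j)"
  by (simp only: qnum_poly_def poly3_simps poly3_vars)

lemma poly3_conv_weight: "poly3 (conv_weight [:0, 1:] [:[:0, 1:]:] i) x y t = conv_weight x y i"
  by (cases "i = 1") (simp_all only: conv_weight_def poly3_simps poly3_vars if_True if_False simp_thms)

lemma poly3_kishore_N:
  "poly3 (kishore_N n) x y t = (if n \<le> 1 then 1 else
     \<Sum>i\<in>{1..<n}. conv_weight x y i * poly3 (kishore_N i) x y t * poly3 (kishore_N (n - i)) x y t *
       (\<Prod>k\<in>{1..<n}. (t + y * (\<Sum>j<k. x ^ j)) ^ (n div k - i div k - (n - i) div k)))"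
  by (subst kishore_N.simps) (simp add: poly3_simps poly3_qnum_poly poly3_conv_weight)

text \<open>The denominators are cleared because \<open>\<lfloor>i/k\<rfloor> + \<lfloor>(n-i)/k\<rfloor> \<le> \<lfloor>n/k\<rfloor>\<close>, and because \<open>b n\<close> occurs
  in \<open>D n\<close> exactly once and neither in \<open>D i\<close> nor in \<open>D (n - i)\<close>.\<close>

lemma convolution_recurrence_clear_denominators:
  fixes b e s N :: "nat \<Rightarrow> 'a::comm_semiring_1"
  assumes s1: "s 1 * b 1 = 1"
    and s: "\<And>n. n \<ge> 2 \<Longrightarrow> s n * b n = (\<Sum>i\<in>{1..<n}. e i * s i * s (n - i))"
    and N: "\<And>n. N n = (if n \<le> 1 then 1 else \<Sum>i\<in>{1..<n}. e i * N i * N (n - i) *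
       (\<Prod>k\<in>{1..<n}. b k ^ (n div k - i div k - (n - i) div k)))"
    and "n \<ge> 1"
  shows "s n * (\<Prod>k=1..n. b k ^ (n div k)) = N n"
  using \<open>n \<ge> 1\<close>
proof (induction n rule: less_induct)
  case (less n)
  show ?case
  proof (cases "n = 1")
    case True
    then show ?thesis using s1 N[of 1] by simp
  next
    case False
    with less.prems have n: "n \<ge> 2" by simp
    let ?D = "\<lambda>i. \<Prod>k=1..i. b k ^ (i div k)"
    have D: "?D i = (\<Prod>k\<in>{1..<n}. b k ^ (i div k))" if "i < n" for i
      using that by (intro prod.mono_neutral_left) auto
    have split: "(\<Prod>k\<in>{1..<n}. b k ^ (n div k)) =
        ?D i * ?D (n - i) * (\<Prod>k\<in>{1..<n}. b k ^ (n div k - i div k - (n - i) div k))"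
      if "i \<in> {1..<n}" for i
    proof -
      have "n div k = i div k + (n - i) div k + (n div k - i div k - (n - i) div k)" for k
        using that div_add1_eq[of i "n - i" k] by simp
      then have "b k ^ (n div k) = b k ^ (i div k) * b k ^ ((n - i) div k) *
          b k ^ (n div k - i div k - (n - i) div k)" for k
        by (metis power_add)
      moreover have "?D i = (\<Prod>k\<in>{1..<n}. b k ^ (i div k))"
        "?D (n - i) = (\<Prod>k\<in>{1..<n}. b k ^ ((n - i) div k))"
        using that D[of i] D[of "n - i"] by simp_all
      ultimately show ?thesis
        by (simp only: prod.distrib)
    qed
    have "{1..n} = insert n {1..<n}" using n by auto
    then have "?D n = b n * (\<Prod>k\<in>{1..<n}. b k ^ (n div k))" using n by simp
    then have "s n * ?D n = (\<Sum>i\<in>{1..<n}. e i * s i * s (n - i)) * (\<Prod>k\<in>{1..<n}. b k ^ (n div k))"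
      using s[OF n] by (simp flip: mult.assoc)
    also have "\<dots> = (\<Sum>i\<in>{1..<n}. e i * (s i * ?D i) * (s (n - i) * ?D (n - i)) *
        (\<Prod>k\<in>{1..<n}. b k ^ (n div k - i div k - (n - i) div k)))"
      unfolding sum_distrib_right
      by (intro sum.cong refl) (subst split, simp_all add: mult_ac)
    also have "\<dots> = N n"
      using n less.IH by (subst N[of n]) (auto intro!: sum.cong)
    finally show ?thesis .
  qed
qed

section \<open>The series psi, its q-difference equation and the Riccati equation\<close>

definition psi :: "complex \<Rightarrow> complex \<Rightarrow> complex fps" where
  "psi a q = Abs_fps (\<lambda>n. (-1) ^ n * q ^ (n choose 2) / (qpoch q q n * qpoch a q n))"

lemma qpoch_Suc: "qpoch a p (Suc n) = qpoch a p n * (1 - a * p ^ n)"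
  by (simp add: qpoch_def)

lemma qpoch_Suc': "qpoch a p (Suc n) = (1 - a) * qpoch (a * p) p n"
  unfolding qpoch_def prod.lessThan_Suc_shift by (simp add: mult_ac)

lemma qpoch_nonzero: "(\<And>n. a * p ^ n \<noteq> 1) \<Longrightarrow> qpoch a p n \<noteq> 0"
  by (auto simp: qpoch_def)

lemma choose_two_Suc: "Suc n choose 2 = (n choose 2) + n"
  by (simp add: numeral_2_eq_2)

lemma fps_nth_compose_monom:
  fixes f :: "'a::idom fps"
  assumes "d > 0"
  shows "fps_nth (f oo (fps_const c * fps_X ^ d)) m =
    (if d dvd m then fps_nth f (m div d) * c ^ (m div d) else 0)"
proof -
  have "fps_nth ((fps_const c * fps_X ^ d) ^ i) m = (if m = d * i then c ^ i else 0)" for i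
    by (simp add: power_mult_distrib fps_const_power flip: power_mult)
  then have "fps_nth (f oo (fps_const c * fps_X ^ d)) m =
      (\<Sum>i=0..m. if m = d * i then fps_nth f i * c ^ i else 0)"
    by (auto simp: fps_compose_nth intro!: sum.cong)
  also have "\<dots> = (if d dvd m then fps_nth f (m div d) * c ^ (m div d) else 0)"
  proof (cases "d dvd m")
    case True
    then have "m = d * i \<longleftrightarrow> i = m div d" for i
      using assms by auto
    then show ?thesis using True by simp
  next
    case False
    then show ?thesis by (auto intro!: sum.neutral)
  qed
  finally show ?thesis .
qed

lemma fps_compose_divide_distrib:
  fixes f g h :: "'a::field fps"
  assumes "fps_nth g 0 \<noteq> 0" "fps_nth h 0 = 0"
  shows "(f / g) oo h = (f oo h) / (g oo h)"
proof -
  have "(f / g) * g = f"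
    using assms(1) by (simp add: fps_divide_unit mult.assoc inverse_mult_eq_1)
  then have "((f / g) oo h) * (g oo h) = f oo h"
    using fps_compose_mult_distrib[OF assms(2)] by metis
  moreover have "fps_nth (g oo h) 0 \<noteq> 0"
    using assms by simp
  ultimately show ?thesis
    by (metis fps_nonzeroI nonzero_mult_div_cancel_right)
qed

lemma psi_nth_0 [simp]: "fps_nth (psi a q) 0 = 1"
  by (simp add: psi_def qpoch_def binomial_eq_0)

text \<open>Here \<open>y\<close> stands for q^\<nu> but is kept arbitrary; the first two conditions
  keep (q;q)_n and (yq;q)_n nonzero, so no coefficient of \<open>psi (y * q) q\<close> is a junk
  value.\<close>

locale q_parameters =
  fixes q y :: complex
  assumes q_ne: "\<And>n. q * q ^ n \<noteq> 1" and y_ne: "\<And>n. y * q * q ^ n \<noteq> 1" and q1: "q \<noteq> 1"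
begin

definition shift :: "complex fps \<Rightarrow> complex fps" where
  "shift f = f oo (fps_const q * fps_X)"

lemma shift_nth: "fps_nth (shift f) n = fps_nth f n * q ^ n"
  using fps_nth_compose_monom[of 1 f q n] by (simp add: shift_def)

lemma shift_mult: "shift (f * h) = shift f * shift h"
  unfolding shift_def by (rule fps_compose_mult_distrib) simp

lemma shift_one_plus: "shift (1 + f) = 1 + shift f"
  by (simp add: shift_def fps_compose_add_distrib)

definition quot :: "complex fps" where
  "quot = shift (psi (y * q * q) q) / psi (y * q) q"

definition g :: "complex fps" where
  "g = fps_const (1 / (1 - y * q)) * fps_X * quot"

lemma psi_Suc:
  "fps_nth (psi (y * q) q) (Suc n) * (1 - q * q ^ n) * (1 - y * q * q ^ n) =
     - fps_nth (psi (y * q) q) n * q ^ n"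
proof -
  have "qpoch q q n \<noteq> 0" "qpoch (y * q) q n \<noteq> 0" "1 - q * q ^ n \<noteq> 0" "1 - y * q * q ^ n \<noteq> 0"
    using qpoch_nonzero q_ne y_ne by (blast, blast, auto)
  then show ?thesis
    unfolding psi_def by (simp add: qpoch_Suc choose_two_Suc power_add)
qed

text \<open>With a = y q, both (1 - a) (aq;q)_n and (a;q)_n (1 - a q^n) equal (a;q)_{n+1}.\<close>

lemma psi_contiguous:
  "fps_nth (psi (y * q * q) q) n * (1 - y * q * q ^ n) = (1 - y * q) * fps_nth (psi (y * q) q) n"
proof -
  have ne: "qpoch (y * q) q n \<noteq> 0" "1 - y * q * q ^ n \<noteq> 0" "1 - y * q \<noteq> 0"
    using qpoch_nonzero y_ne y_ne[of 0] by (blast, auto)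
  have eq: "(1 - y * q) * qpoch (y * q * q) q n = qpoch (y * q) q n * (1 - y * q * q ^ n)"
    by (metis qpoch_Suc qpoch_Suc')
  then have "qpoch (y * q * q) q n = qpoch (y * q) q n * (1 - y * q * q ^ n) / (1 - y * q)"
    using ne(3) by (simp add: field_simps)
  then show ?thesis
    unfolding psi_def using ne by simp
qed

text \<open>In psi(qu) - psi(u) the coefficient of u^{m+1} is that of psi times q^{m+1} - 1; the
  term ratio \<open>psi_Suc\<close> and \<open>psi_contiguous\<close> turn it into a coefficient of
  the numerator of \<open>g\<close>.\<close>

lemma shift_psi: "shift (psi (y * q) q) = psi (y * q) q * (1 + g)"
proof -
  let ?A = "psi (y * q) q" and ?B = "psi (y * q * q) q"
  have a: "1 - y * q \<noteq> 0" using y_ne[of 0] by simp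
  have "?A * g = fps_const (1 / (1 - y * q)) * fps_X * (quot * ?A)"
    by (simp add: g_def mult_ac)
  also have "quot * ?A = shift ?B"
    unfolding quot_def by (simp add: fps_divide_unit mult.assoc inverse_mult_eq_1)
  also have "fps_const (1 / (1 - y * q)) * fps_X * shift ?B = shift ?A - ?A"
  proof (rule fps_ext)
    fix n
    show "fps_nth (fps_const (1 / (1 - y * q)) * fps_X * shift ?B) n = fps_nth (shift ?A - ?A) n"
    proof (cases n)
      case 0
      then show ?thesis by (simp add: mult.assoc shift_nth)
    next
      case (Suc m)
      have ne: "1 - y * q * q ^ m \<noteq> 0" using y_ne[of m] by simp
      have "(fps_nth ?B m * q ^ m) * (1 - y * q * q ^ m)
          = (1 - y * q) * (fps_nth ?A (Suc m) * (q * q ^ m - 1)) * (1 - y * q * q ^ m)"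
      proof -
        have "b * p * d = k * (c * (r - 1)) * d"
          if "b * d = k * a" "c * (1 - r) * d = - a * p" for a b c d k p r :: complex
          using that by algebra
        then show ?thesis
          using psi_contiguous[of m] psi_Suc[of m] by blast
      qed
      then have "fps_nth ?B m * q ^ m = (1 - y * q) * (fps_nth ?A (Suc m) * (q * q ^ m - 1))"
        using ne by (metis mult_right_cancel)
      then show ?thesis
        using a Suc by (simp add: mult.assoc shift_nth field_simps)
    qed
  qed
  finally show ?thesis by (simp add: algebra_simps)
qed

text \<open>The operator on the left factors as (1 - shift)(1 - y shift), so it multiplies the
  coefficient of u^n by (1 - q^n)(1 - y q^n); \<open>psi_Suc\<close> then lowers the index.\<close>

lemma psi_second_order:
  "psi (y * q) q - (1 + fps_const y) * shift (psi (y * q) q)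
     + fps_const y * shift (shift (psi (y * q) q)) = - (fps_X * shift (psi (y * q) q))"
  (is "?L = ?R")
proof (rule fps_ext)
  fix n
  show "fps_nth ?L n = fps_nth ?R n"
  proof (cases n)
    case 0
    then show ?thesis by (simp add: shift_nth)
  next
    case (Suc m)
    then show ?thesis
      using psi_Suc[of m] by (simp add: shift_nth distrib_right) (simp add: algebra_simps)
  qed
qed

text \<open>One shift of psi contributes 1 + g, two shifts contribute (1 + g)(1 + shift g);
  cancelling psi lowers the order of the equation by one.\<close>

lemma g_riccati: "g = fps_X * (1 + g) + fps_const y * (shift g * (1 + g))"
proof -
  let ?A = "psi (y * q) q"
  have "psi (y * q) q * (1 - (1 + fps_const y) * (1 + g) + fps_const y * ((1 + g) * (1 + shift g)))
      = psi (y * q) q * (- (fps_X * (1 + g)))"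
    using psi_second_order unfolding shift_psi shift_mult shift_one_plus
    by (simp add: algebra_simps del: fps_const_neg)
  moreover have "?A \<noteq> 0"
    using fps_nonzeroI[of ?A 0] by simp
  ultimately have "1 - (1 + fps_const y) * (1 + g) + fps_const y * ((1 + g) * (1 + shift g))
      = - (fps_X * (1 + g))"
    using mult_left_cancel by blast
  then show ?thesis by (simp add: algebra_simps del: fps_const_neg)
qed

section \<open>Coefficient recurrences and the normalized coefficients\<close>

lemma g_nth_0 [simp]: "fps_nth g 0 = 0"
  by (simp add: g_def mult.assoc)

lemma g_nth_1: "fps_nth g 1 * (1 - y * q) = 1"
  using y_ne[of 0] by (simp add: g_def quot_def mult.assoc shift_nth)

lemma g_nth_recurrence:
  assumes "n \<ge> 2"
  shows "fps_nth g n * (1 - y * q ^ n) =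
    fps_nth g (n - 1) + y * (\<Sum>i\<in>{1..<n}. q ^ i * fps_nth g i * fps_nth g (n - i))"
proof -
  \<comment> \<open>The term i = 0 vanishes since \<open>g\<close> has no constant term; the term i
    = n contains g_n and moves to the left, producing 1 - y q^n.\<close>
  have set: "{0..n} = insert 0 (insert n {1..<n})" using assms by auto
  have "fps_nth (shift g * (1 + g)) n = (\<Sum>i\<in>{0..n}. q ^ i * fps_nth g i * fps_nth (1 + g) (n - i))"
    unfolding fps_mult_nth shift_nth by (simp add: mult_ac)
  also have "\<dots> = q ^ n * fps_nth g n + (\<Sum>i\<in>{1..<n}. q ^ i * fps_nth g i * fps_nth g (n - i))"
    unfolding set using assms by simp
  finally have "fps_nth g n = fps_nth g (n - 1) +
      y * (q ^ n * fps_nth g n + (\<Sum>i\<in>{1..<n}. q ^ i * fps_nth g i * fps_nth g (n - i)))"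
    using assms arg_cong[OF g_riccati, of "\<lambda>f. fps_nth f n"] by simp
  then show ?thesis by (simp add: algebra_simps)
qed

text \<open>The exponent comes from w = (1 - q) z. For the pair i, n - i the exponents add up to 2 n
  - 2, which leaves one 1 - q as the denominator of [n + \<nu>].\<close>

definition s :: "nat \<Rightarrow> complex" where
  "s n = (1 - q) ^ (2 * n - 1) * fps_nth g n"

lemma s_eq_quot: "s (Suc n) = (1 - q) ^ (2 * n + 1) * fps_nth quot n / (1 - y * q)"
  by (simp add: s_def g_def mult.assoc)

lemma s_1: "s 1 * ((1 - y * q) / (1 - q)) = 1"
  using g_nth_1 q1 by (simp add: s_def)

text \<open>The term \<open>(1 - q) s\<^bsub>n-1\<^esub>\<close> is not manifestly positive, but \<open>(1 - q) s\<^bsub>n-1\<^esub> = (1 - y q) s\<^sub>1 s\<^bsub>n-1\<^esub>\<close>, and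
  \<open>1 - y q\<close> cancels against the coefficient \<open>y q\<close> of \<open>s\<^sub>1 s\<^bsub>n-1\<^esub>\<close> in the convolution.\<close>

lemma s_recurrence:
  assumes n: "n \<ge> 2"
  shows "s n * ((1 - y * q ^ n) / (1 - q)) = (\<Sum>i\<in>{1..<n}. conv_weight q y i * s i * s (n - i))"
proof -
  have q': "1 - q \<noteq> 0" using q1 by simp
  have conv: "(1 - q) ^ (2 * n - 2) * (q ^ i * fps_nth g i * fps_nth g (n - i)) =
      q ^ i * s i * s (n - i)" if "i \<in> {1..<n}" for i
  proof -
    have "2 * n - 2 = (2 * i - 1) + (2 * (n - i) - 1)" using that by auto
    then show ?thesis by (simp add: s_def power_add mult_ac)
  qed
  have "s n * ((1 - y * q ^ n) / (1 - q)) = (1 - q) ^ (2 * n - 2) * (fps_nth g n * (1 - y * q ^ n))"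
  proof -
    have "2 * n - 1 = Suc (2 * n - 2)" using n by simp
    then show ?thesis using q' by (simp add: s_def)
  qed
  also have "\<dots> = (1 - q) ^ (2 * n - 2) * fps_nth g (n - 1) +
      y * (\<Sum>i\<in>{1..<n}. q ^ i * s i * s (n - i))"
  proof -
    have "(1 - q) ^ (2 * n - 2) * (\<Sum>i\<in>{1..<n}. q ^ i * fps_nth g i * fps_nth g (n - i)) =
        (\<Sum>i\<in>{1..<n}. q ^ i * s i * s (n - i))"
      unfolding sum_distrib_left by (rule sum.cong[OF refl conv])
    then show ?thesis
      unfolding g_nth_recurrence[OF n] distrib_left by (simp only: mult.left_commute)
  qed
  also have "(1 - q) ^ (2 * n - 2) * fps_nth g (n - 1) = (1 - q) * s (n - 1)"
  proof -
    have "2 * n - 2 = Suc (2 * (n - 1) - 1)" using n by auto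
    then show ?thesis unfolding s_def by (simp only: power_Suc mult.assoc)
  qed
  also have "(1 - q) * s (n - 1) = (1 - y * q) * s 1 * s (n - 1)"
  proof -
    have "1 - q = (1 - y * q) * s 1"
      using s_1 q' by (simp add: field_simps)
    then show ?thesis by (simp only:)
  qed
  also have "(1 - y * q) * s 1 * s (n - 1) + y * (\<Sum>i\<in>{1..<n}. q ^ i * s i * s (n - i)) =
      (\<Sum>i\<in>{1..<n}. conv_weight q y i * s i * s (n - i))"
  proof -
    have "{1..<n} = insert 1 {2..<n}" using n by auto
    moreover have "(\<Sum>i\<in>{2..<n}. conv_weight q y i * s i * s (n - i)) =
        y * (\<Sum>i\<in>{2..<n}. q ^ i * s i * s (n - i))"
      by (auto simp: sum_distrib_left conv_weight_def mult_ac intro!: sum.cong)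
    ultimately show ?thesis
      by (simp add: conv_weight_def algebra_simps)
  qed
  finally show ?thesis .
qed

lemma s_eq_kishore:
  assumes n: "n \<ge> 1"
  shows "s n = poly3 (kishore_N n) q y ((1 - y) / (1 - q)) /
    (\<Prod>k=1..n. ((1 - y * q ^ k) / (1 - q)) ^ (n div k))"
proof -
  let ?b = "\<lambda>k. (1 - y * q ^ k) / (1 - q)"
  have b: "(1 - y) / (1 - q) + y * (\<Sum>j<k. q ^ j) = ?b k" for k
    using q1 by (simp add: sum_gp_strict add_divide_distrib[symmetric] algebra_simps)
  have "s n * (\<Prod>k=1..n. ?b k ^ (n div k)) = poly3 (kishore_N n) q y ((1 - y) / (1 - q))"
    by (rule convolution_recurrence_clear_denominators[where e = "conv_weight q y"])
      (use s_1 s_recurrence n poly3_kishore_N[of _ q y "(1 - y) / (1 - q)", unfolded b] in simp_all)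
  moreover have "?b k \<noteq> 0" if "k \<in> {1..n}" for k
    using y_ne[of "k - 1"] q1 that by (cases k) (auto simp: mult_ac)
  then have "(\<Prod>k=1..n. ?b k ^ (n div k)) \<noteq> 0"
    by (simp add: prod_zero_iff)
  ultimately show ?thesis by (simp add: field_simps)
qed

text \<open>Serves both bases: \<kappa> = q (1 - q)^2 for base q and \<kappa> = y q (1 - q)^2 for
  base 1/q. In either case the numerator has q \<kappa>, matching the shift in
  \<open>quot\<close>.\<close>

lemma compose_quot:
  "fps_const c * fps_X * ((psi (y * q * q) q oo (fps_const (q * \<kappa>) * fps_X ^ 2)) /
     (psi (y * q) q oo (fps_const \<kappa> * fps_X ^ 2))) =
   fps_odd (\<lambda>n. c * fps_nth quot (n - 1) * \<kappa> ^ (n - 1))"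
proof -
  have 1: "psi (y * q * q) q oo (fps_const (q * \<kappa>) * fps_X ^ 2) =
      shift (psi (y * q * q) q) oo (fps_const \<kappa> * fps_X ^ 2)"
    by (rule fps_ext)
      (auto simp: fps_nth_compose_monom shift_nth power_mult_distrib mult_ac)
  have 2: "(psi (y * q * q) q oo (fps_const (q * \<kappa>) * fps_X ^ 2)) /
     (psi (y * q) q oo (fps_const \<kappa> * fps_X ^ 2)) = quot oo (fps_const \<kappa> * fps_X ^ 2)"
    unfolding 1 quot_def by (subst fps_compose_divide_distrib) auto
  show ?thesis
    unfolding 2
    by (rule fps_ext)
      (auto simp: mult.assoc fps_odd_def fps_nth_compose_monom elim!: oddE)
qed

end

section \<open>Hahn-Exton series in both bases, expressed by psi\<close>

lemma qpoch_inverse: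
  assumes "a \<noteq> 0" "p \<noteq> 0"
  shows "qpoch (inverse a) (inverse p) n * ((-1) ^ n * a ^ n * p ^ (n choose 2)) = qpoch a p n"
proof (induction n)
  case 0
  then show ?case by (simp add: qpoch_def numeral_2_eq_2)
next
  case (Suc n)
  have "(1 - inverse a * inverse p ^ n) * (- (a * p ^ n)) = 1 - a * p ^ n"
    using assms by (simp add: field_simps)
  then show ?case
    unfolding qpoch_Suc Suc.IH[symmetric] \<open>_ = 1 - a * p ^ n\<close>[symmetric]
    by (simp add: choose_two_Suc power_add mult_ac)
qed

lemma fps_compose_even:
  fixes F P :: "'a::idom fps"
  assumes "\<And>n. fps_nth F (2 * n) = fps_nth P n * \<kappa> ^ n" "\<And>n. odd n \<Longrightarrow> fps_nth F n = 0"
  shows "F oo (fps_const c * fps_X) = P oo (fps_const (\<kappa> * c ^ 2) * fps_X ^ 2)"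
proof (rule fps_ext)
  fix m
  have 1: "fps_nth (F oo (fps_const c * fps_X)) m = fps_nth F m * c ^ m"
    using fps_nth_compose_monom[of 1 F c m] by simp
  have 2: "fps_nth (P oo (fps_const (\<kappa> * c ^ 2) * fps_X ^ 2)) m =
      (if 2 dvd m then fps_nth P (m div 2) * (\<kappa> * c ^ 2) ^ (m div 2) else 0)"
    by (rule fps_nth_compose_monom) simp
  show "fps_nth (F oo (fps_const c * fps_X)) m =
      fps_nth (P oo (fps_const (\<kappa> * c ^ 2) * fps_X ^ 2)) m"
    unfolding 1 2 using assms by (auto elim!: evenE simp: power_mult_distrib power_mult)
qed

lemma hahn_exton_Phi_compose:
  "hahn_exton_Phi \<nu> q oo (fps_const c * fps_X) =
     psi (q powr (\<nu> + 1)) q oo (fps_const (q * c ^ 2) * fps_X ^ 2)"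
  by (rule fps_compose_even) (auto simp: hahn_exton_Phi_def psi_def mult_ac)

lemma inverse_powr_complex:
  fixes q :: complex
  assumes "q \<notin> \<real>\<^sub>\<le>\<^sub>0"
  shows "inverse q powr x = inverse (q powr x)"
proof -
  have "q \<noteq> 0" using assms by auto
  then show ?thesis by (simp add: powr_def Ln_inverse assms exp_minus)
qed

text \<open>With a = q^{\<nu>+1}, inverting the base in (q;q)_n and (a;q)_n releases q^n a^n
  q^{n(n-1)}; this flips the sign of the quadratic exponent and scales w^2 by a instead of
  q.\<close>

lemma hahn_exton_Phi_inverse_compose:
  assumes q: "q \<notin> \<real>\<^sub>\<le>\<^sub>0"
  shows "hahn_exton_Phi \<nu> (inverse q) oo (fps_const c * fps_X) =
     psi (q powr (\<nu> + 1)) q oo (fps_const (q powr (\<nu> + 1) * c ^ 2) * fps_X ^ 2)"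
proof (rule fps_compose_even)
  define a where "a = q powr (\<nu> + 1)"
  have ne: "q \<noteq> 0" "a \<noteq> 0" using q by (auto simp: a_def)
  fix n
  let ?P = "qpoch (inverse q) (inverse q) n" and ?A = "qpoch (inverse a) (inverse q) n"
    and ?Q = "q ^ (n choose 2)"
  have "(-1) ^ n * inverse ?Q * inverse (q ^ n) / (?P * ?A) =
      (-1) ^ n * ?Q / ((?P * ((-1) ^ n * q ^ n * ?Q)) * (?A * ((-1) ^ n * a ^ n * ?Q))) * a ^ n"
  proof -
    \<comment> \<open>Here e = (-1)^n, d = q^(n choose 2), r = q^n and b = a^n; if \<open>P\<close>
      or \<open>A\<close> is 0, both sides are 0 because x / 0 = 0.\<close>
    have "e * inverse d * inverse r / (P * A) =
        e * d / ((P * (e * r * d)) * (A * (e * b * d))) * b"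
      if "e * e = 1" "d \<noteq> 0" "r \<noteq> 0" "b \<noteq> 0" for e d r P A b :: complex
      using that by (cases "P = 0 \<or> A = 0") (auto simp: field_simps)
    then show ?thesis
      using ne by (simp flip: power_mult_distrib)
  qed
  then show "fps_nth (hahn_exton_Phi \<nu> (inverse q)) (2 * n) =
      fps_nth (psi (q powr (\<nu> + 1)) q) n * (q powr (\<nu> + 1)) ^ n"
    unfolding qpoch_inverse[OF ne(1) ne(1)] qpoch_inverse[OF ne(2) ne(1)]
    by (simp add: hahn_exton_Phi_def psi_def inverse_powr_complex[OF q] power_inverse
        del: inverse_eq_divide flip: a_def)
qed (simp add: hahn_exton_Phi_def)

section \<open>The quotient for base q and the two expansions\<close>

lemma fps_odd_cong: "(\<And>n. a (Suc n) = b (Suc n)) \<Longrightarrow> fps_odd a = fps_odd b"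
  by (rule fps_ext) (auto simp: fps_odd_def elim!: oddE)

lemma fps_const_mult_fps_odd: "fps_const c * fps_odd a = fps_odd (\<lambda>n. c * a n)"
  by (rule fps_ext) (simp add: fps_odd_def)

lemma uminus_fps_odd: "- fps_odd a = fps_odd (\<lambda>n. - a n)"
  by (rule fps_ext) (simp add: fps_odd_def)

text \<open>The principal values multiply because \<open>\<bar>arg (1 - q)\<bar> < \<pi>/2\<close> and \<open>\<bar>arg q\<bar>/2 < \<pi>/2\<close>.\<close>

lemma powr_mult_csqrt:
  fixes q :: complex
  assumes "norm q < 1" "q \<notin> \<real>\<^sub>\<le>\<^sub>0"
  shows "((1 - q) * q powr (1 / 2)) powr x = (1 - q) powr x * q powr (x / 2)"
proof -
  have q: "q \<noteq> 0" "1 - q \<noteq> 0" using assms by auto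
  have "Re (1 - q) > 0"
    using assms(1) complex_Re_le_cmod[of q] by simp
  then have 1: "\<bar>Im (Ln (1 - q))\<bar> < pi / 2"
    by (rule Re_Ln_pos_lt_imp)
  have im: "- pi < Im (Ln q)" "Im (Ln q) \<le> pi"
    using q by (auto simp: mpi_less_Im_Ln Im_Ln_le_pi)
  have "Ln (exp (Ln q / 2)) = Ln q / 2"
    using im by (intro Ln_exp) auto
  then have 2: "Ln (q powr (1 / 2)) = Ln q / 2"
    using q by (simp add: powr_def)
  have "Ln ((1 - q) * q powr (1 / 2)) = Ln (1 - q) + Ln q / 2"
    using q 1 im by (subst Ln_times) (auto simp: 2)
  then show ?thesis
    using q by (simp add: powr_def distrib_left exp_add mult_ac)
qed

text \<open>The infinite products cancel up to the factor 1 - q^{\<nu>+1}, and (1 - q)^\<nu>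
  cancels; of the powers only (1 - q) q^{(\<nu>+1)/2} survives.\<close>

lemma hahn_exton_quot_eq:
  assumes q: "norm q < 1" "q \<notin> \<real>\<^sub>\<le>\<^sub>0"
    and ne: "\<And>n. q powr \<nu> * q * q ^ n \<noteq> 1" "\<And>n. q * q ^ n \<noteq> 1"
  shows "hahn_exton_quot \<nu> q ((1 - q) * q powr (1 / 2)) (1 - q) =
    fps_const ((1 - q) * q powr ((\<nu> + 1) / 2) / (1 - q powr \<nu> * q)) * fps_X *
    ((hahn_exton_Phi (\<nu> + 1) q oo (fps_const ((1 - q) * q powr (1 / 2)) * fps_X)) /
     (hahn_exton_Phi \<nu> q oo (fps_const (1 - q) * fps_X)))"
proof -
  have q': "q \<noteq> 0" "1 - q \<noteq> 0" using q by auto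
  define a where "a = q powr \<nu> * q"
  have a: "q powr (\<nu> + 1) = a" "q powr (\<nu> + 1 + 1) = a * q"
    using q' by (simp_all add: powr_add a_def power2_eq_square)
  let ?A = "qpoch_inf a q" and ?B = "qpoch_inf (a * q) q" and ?P = "qpoch_inf q q"
  have A: "?A \<noteq> 0" "?A = (1 - a) * ?B"
    using qpoch_inf_nonzero[OF q(1), of a] ne(1) unfolding a_def by blast+
  have P: "?P \<noteq> 0"
    using qpoch_inf_nonzero(1)[OF q(1), of q] ne(2) by blast
  have nz: "?B \<noteq> 0" "1 - a \<noteq> 0" "(1 - q) powr \<nu> \<noteq> 0"
    using A q' by auto
  let ?K1 = "?B * ((1 - q) * q powr (1 / 2)) powr (\<nu> + 1) / ?P"
    and ?K2 = "?A * (1 - q) powr \<nu> / ?P"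
  have "((1 - q) * q powr (1 / 2)) powr (\<nu> + 1) = (1 - q) * (1 - q) powr \<nu> * q powr ((\<nu> + 1) / 2)"
    unfolding powr_mult_csqrt[OF q] using q' by (simp add: powr_add)
  then have K: "?K1 / ?K2 = (1 - q) * q powr ((\<nu> + 1) / 2) / (1 - a)"
    using nz P unfolding A(2) by simp
  have K2: "?K2 \<noteq> 0" using A nz P by simp
  have quot: "(fps_const x * f) / (fps_const z * h) = fps_const (x / z) * (f / h)"
    if "z \<noteq> 0" "fps_nth h 0 \<noteq> 0" for x z :: complex and f h
    using that by (simp add: fps_divide_unit fps_inverse_mult fps_const_inverse
        divide_inverse mult_ac flip: fps_const_mult)
  have G0: "fps_nth (hahn_exton_Phi \<nu> q oo (fps_const (1 - q) * fps_X)) 0 \<noteq> 0"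
    by (simp add: hahn_exton_Phi_def qpoch_def)
  show ?thesis
    unfolding hahn_exton_quot_def hahn_exton_J_def a quot[OF K2 G0] K
    by (simp only: a_def mult_ac)
qed

theorem theorem2p8:
  fixes \<nu> :: complex
  assumes "\<And>k::nat. k \<ge> 1 \<Longrightarrow> \<nu> \<noteq> - of_nat k"
  shows "\<exists>N :: nat \<Rightarrow> nat poly poly poly. \<forall>q::complex.
    norm q < 1 \<and> q \<notin> \<real>\<^sub>\<le>\<^sub>0 \<and> (\<forall>k::nat. k \<ge> 1 \<longrightarrow> q powr (of_nat k + \<nu>) \<noteq> 1) \<longrightarrow>
      hahn_exton_formal_quot \<nu> (inverse q) (1 - q) =
        - fps_odd (\<lambda>n. poly3 (N n) q (q powr \<nu>) (qnum q \<nu>) / kishore_D n \<nu> q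
                       * q powr ((\<nu> + 1) * of_nat n)) \<and>
      hahn_exton_quot \<nu> q ((1 - q) * q powr (1 / 2)) (1 - q) =
        fps_const (q powr ((\<nu> - 1) / 2)) *
        fps_odd (\<lambda>n. poly3 (N n) q (q powr \<nu>) (qnum q \<nu>) / kishore_D n \<nu> q * q ^ n)"
\<comment> \<open>\<open>kishore_N\<close> is fixed before q is given and does not depend on
  \<nu>.\<close>
proof (intro exI[of _ kishore_N] allI impI)
  fix q :: complex
  assume asm: "norm q < 1 \<and> q \<notin> \<real>\<^sub>\<le>\<^sub>0 \<and> (\<forall>k::nat. k \<ge> 1 \<longrightarrow> q powr (of_nat k + \<nu>) \<noteq> 1)"
  then have q: "norm q < 1" "q \<notin> \<real>\<^sub>\<le>\<^sub>0" "q \<noteq> 0" "q \<noteq> 1" by auto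
  define y where "y = q powr \<nu>"
  have pw: "q powr (of_nat k + \<nu>) = y * q ^ k" for k
    using q by (simp add: powr_add y_def powr_nat')
  have yq: "q powr (\<nu> + 1) = y * q" "q powr (\<nu> + 1 + 1) = y * q * q"
    using q by (simp_all add: powr_add y_def power2_eq_square)
  have "norm (q * q ^ n) < 1" for n
    using q power_Suc_less_one[of "norm q" n] by (simp add: norm_mult norm_power)
  then have q_ne: "q * q ^ n \<noteq> 1" for n
    by (metis norm_one less_irrefl)
  have y_ne: "y * q * q ^ n \<noteq> 1" for n
    using asm pw[of "Suc n"] by (auto simp: mult.assoc dest: spec[of _ "Suc n"])
  interpret q_parameters q y
    using q_ne y_ne q by unfold_locales auto
  have y1: "1 - y * q \<noteq> 0" "1 - inverse (y * q) \<noteq> 0" "y * q \<noteq> 0"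
    using y_ne[of 0] q by (auto simp: y_def simp del: inverse_mult_distrib)
  have s: "poly3 (kishore_N n) q (q powr \<nu>) (qnum q \<nu>) / kishore_D n \<nu> q = s n" if "n \<ge> 1" for n
    unfolding s_eq_kishore[OF that] kishore_D_def qnum_def pw y_def[symmetric] ..
  have "q powr ((\<nu> + 1) * of_nat n) = (y * q) ^ n" for n
    unfolding yq(1)[symmetric] using q by (simp add: powr_def exp_of_nat_mult mult_ac)
  moreover have "hahn_exton_formal_quot \<nu> (inverse q) (1 - q) =
      - fps_odd (\<lambda>n. s n * (y * q) ^ n)"
  proof -
    have "hahn_exton_formal_quot \<nu> (inverse q) (1 - q) =
        fps_odd (\<lambda>n. (1 - q) / (1 - inverse (y * q)) * fps_nth quot (n - 1) *
          (y * q * (1 - q)\<^sup>2) ^ (n - 1))"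
      unfolding hahn_exton_formal_quot_def inverse_powr_complex[OF q(2)]
        hahn_exton_Phi_inverse_compose[OF q(2)] yq compose_quot[symmetric]
      by (simp only: mult_ac)
    also have "\<dots> = - fps_odd (\<lambda>n. s n * (y * q) ^ n)"
    proof (subst uminus_fps_odd, rule fps_odd_cong)
      fix n
      \<comment> \<open>Source of the minus sign in the first expansion, and of the last factor of
        (y q)^n.\<close>
      have "(1 - q) / (1 - inverse (y * q)) = - ((1 - q) * (y * q) / (1 - y * q))"
        using y1 by (simp add: divide_simps) (simp add: algebra_simps)
      then show "(1 - q) / (1 - inverse (y * q)) * fps_nth quot (Suc n - 1) *
          (y * q * (1 - q)\<^sup>2) ^ (Suc n - 1) = - (s (Suc n) * (y * q) ^ Suc n)"
        by (simp add: s_eq_quot power_mult_distrib mult_ac flip: power_mult)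
    qed
    finally show ?thesis .
  qed
  moreover have "hahn_exton_quot \<nu> q ((1 - q) * q powr (1 / 2)) (1 - q) =
      fps_const (q powr ((\<nu> - 1) / 2)) * fps_odd (\<lambda>n. s n * q ^ n)"
  proof -
    let ?c = "(1 - q) * q powr ((\<nu> + 1) / 2) / (1 - y * q)"
    have "q powr (1 / 2) * q powr (1 / 2) = q"
      using q by (simp flip: powr_add)
    then have sq: "q * ((1 - q) * q powr (1 / 2))\<^sup>2 = q * (q * (1 - q)\<^sup>2)"
      by (simp add: power2_eq_square mult_ac)
    \<comment> \<open>The factor q split off here raises q^{n-1} to q^n.\<close>
    have half: "q powr ((\<nu> + 1) / 2) = q powr ((\<nu> - 1) / 2) * q"
    proof -
      have "(\<nu> + 1) / 2 = (\<nu> - 1) / 2 + 1" by (simp add: field_simps)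
      then show ?thesis using q by (simp only: powr_add) simp
    qed
    have "hahn_exton_quot \<nu> q ((1 - q) * q powr (1 / 2)) (1 - q) =
        fps_odd (\<lambda>n. ?c * fps_nth quot (n - 1) * (q * (1 - q)\<^sup>2) ^ (n - 1))"
      unfolding hahn_exton_quot_eq[OF q(1,2) y_ne[unfolded y_def] q_ne]
        hahn_exton_Phi_compose yq y_def[symmetric] sq by (rule compose_quot)
    also have "\<dots> = fps_const (q powr ((\<nu> - 1) / 2)) * fps_odd (\<lambda>n. s n * q ^ n)"
      unfolding fps_const_mult_fps_odd half
      by (rule fps_odd_cong) (simp add: s_eq_quot power_mult_distrib mult_ac flip: power_mult)
    finally show ?thesis .
  qed
  ultimately show "hahn_exton_formal_quot \<nu> (inverse q) (1 - q) =
        - fps_odd (\<lambda>n. poly3 (kishore_N n) q (q powr \<nu>) (qnum q \<nu>) / kishore_D n \<nu> q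
                       * q powr ((\<nu> + 1) * of_nat n)) \<and>
      hahn_exton_quot \<nu> q ((1 - q) * q powr (1 / 2)) (1 - q) =
        fps_const (q powr ((\<nu> - 1) / 2)) *
        fps_odd (\<lambda>n. poly3 (kishore_N n) q (q powr \<nu>) (qnum q \<nu>) / kishore_D n \<nu> q * q ^ n)"
    \<comment> \<open>\<open>fps_odd_cong\<close> compares only positive indices, which is where
      \<open>s\<close> applies.\<close>
    using s[symmetric] by (auto intro!: fps_odd_cong arg_cong[where f = uminus] arg_cong2[where f = "(*)"])
qed

end
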